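(* Let $G$ be an infinite abelian group and $A$ a finite set of size $q \geq 2$. Then the monoid $\mathrm{CA}(G;A)$ is not finitely generated.
   Context: For a group $G$ and a finite set $A$, $A^G$ is the set of all functions $x : G \to A$, with the shift action $(g\cdot x)(h) = x(g^{-1}h)$. A cellular automaton over $A^G$ is a map $\tau : A^G \to A^G$ for which there exist a finite subset $S \subseteq G$ and a function $\mu : A^S \to A$ such that $\tau(x)(g) = \mu((g^{-1}\cdot x)|_S)$ for all $x \in A^G$, $g\in G$. $\mathrm{CA}(G;A)$ is the monoid of all cellular automata over $A^G$ under composition. A monoid is finitely generated if it is generated, as a monoid, by a finite subset. *)

theory Defs
  imports "HOL-Algebra.Algebra"
begin

inductive_set monoid_generate :: "('m, 'n) monoid_scheme \<Rightarrow> 'm set \<Rightarrow> 'm set"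
  for M and S where
    one: "\<one>\<^bsub>M\<^esub> \<in> monoid_generate M S"
  | incl: "x \<in> S \<Longrightarrow> x \<in> monoid_generate M S"
  | mult: "x \<in> monoid_generate M S \<Longrightarrow> y \<in> monoid_generate M S \<Longrightarrow> x \<otimes>\<^bsub>M\<^esub> y \<in> monoid_generate M S"

definition finitely_generated_monoid :: "('m, 'n) monoid_scheme \<Rightarrow> bool" where
  "finitely_generated_monoid M \<longleftrightarrow>
     (\<exists>S. finite S \<and> S \<subseteq> carrier M \<and> monoid_generate M S = carrier M)"

text \<open>All function spaces are extensional (value \<^term>\<open>undefined\<close> outside the domain), so that
  equality of configurations and of cellular automata is equality of functions on the carriers.\<close>

definition configs :: "('g, 'n) monoid_scheme \<Rightarrow> 'a set \<Rightarrow> ('g \<Rightarrow> 'a) set" where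
  "configs G A = carrier G \<rightarrow>\<^sub>E A"

definition shift :: "('g, 'n) monoid_scheme \<Rightarrow> 'g \<Rightarrow> ('g \<Rightarrow> 'a) \<Rightarrow> ('g \<Rightarrow> 'a)" where
  "shift G g x = (\<lambda>h\<in>carrier G. x (inv\<^bsub>G\<^esub> g \<otimes>\<^bsub>G\<^esub> h))"

definition cellular_automaton ::
    "('g, 'n) monoid_scheme \<Rightarrow> 'a set \<Rightarrow> (('g \<Rightarrow> 'a) \<Rightarrow> ('g \<Rightarrow> 'a)) \<Rightarrow> bool" where
  "cellular_automaton G A \<tau> \<longleftrightarrow>
     \<tau> \<in> configs G A \<rightarrow>\<^sub>E configs G A \<and>
     (\<exists>S \<mu>. finite S \<and> S \<subseteq> carrier G \<and> \<mu> \<in> (S \<rightarrow>\<^sub>E A) \<rightarrow>\<^sub>E A \<and>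
        (\<forall>x\<in>configs G A. \<forall>g\<in>carrier G. \<tau> x g = \<mu> (restrict (shift G (inv\<^bsub>G\<^esub> g) x) S)))"

definition CA :: "('g, 'n) monoid_scheme \<Rightarrow> 'a set \<Rightarrow> (('g \<Rightarrow> 'a) \<Rightarrow> ('g \<Rightarrow> 'a)) monoid" where
  "CA G A = \<lparr>carrier = {\<tau>. cellular_automaton G A \<tau>},
             monoid.mult = compose (configs G A),
             one = (\<lambda>x\<in>configs G A. x)\<rparr>"

lemma (in group) monoid_CA:
  fixes A :: "'c set"
  shows "monoid (CA G A)"
proof -
  let ?C = "configs G A"
  have loc: "restrict (shift G (inv g) x) S = (\<lambda>s\<in>S. x (g \<otimes> s))"
    if "S \<subseteq> carrier G" "g \<in> carrier G" for S g and x :: "'a \<Rightarrow> 'c"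
    using that by (auto simp: shift_def restrict_def fun_eq_iff)
  have id: "cellular_automaton G A (\<lambda>x\<in>?C. x)"
    unfolding cellular_automaton_def
  proof (intro conjI exI[of _ "{\<one>}"] exI[of _ "\<lambda>p\<in>{\<one>} \<rightarrow>\<^sub>E A. p \<one>"])
    show "\<forall>x\<in>?C. \<forall>g\<in>carrier G. (\<lambda>x\<in>?C. x) x g =
        (\<lambda>p\<in>{\<one>} \<rightarrow>\<^sub>E A. p \<one>) (restrict (shift G (inv g) x) {\<one>})"
      by (auto simp: shift_def configs_def restrict_PiE_iff PiE_iff)
  qed auto
  have comp: "cellular_automaton G A (compose ?C \<sigma> \<tau>)"
    if \<sigma>: "cellular_automaton G A \<sigma>" and \<tau>: "cellular_automaton G A \<tau>" for \<sigma> \<tau>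
  proof -
    obtain S \<mu> where S: "finite S" "S \<subseteq> carrier G" "\<mu> \<in> (S \<rightarrow>\<^sub>E A) \<rightarrow>\<^sub>E A"
      "\<And>x g. x \<in> ?C \<Longrightarrow> g \<in> carrier G \<Longrightarrow> \<sigma> x g = \<mu> (restrict (shift G (inv g) x) S)"
      and \<sigma>C: "\<sigma> \<in> ?C \<rightarrow>\<^sub>E ?C"
      using \<sigma> unfolding cellular_automaton_def by auto
    obtain T \<nu> where T: "finite T" "T \<subseteq> carrier G" "\<nu> \<in> (T \<rightarrow>\<^sub>E A) \<rightarrow>\<^sub>E A"
      "\<And>x g. x \<in> ?C \<Longrightarrow> g \<in> carrier G \<Longrightarrow> \<tau> x g = \<nu> (restrict (shift G (inv g) x) T)"
      and \<tau>C: "\<tau> \<in> ?C \<rightarrow>\<^sub>E ?C"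
      using \<tau> unfolding cellular_automaton_def by auto
    define U where "U = (\<lambda>(s, t). s \<otimes> t) ` (S \<times> T)"
    define \<rho> where "\<rho> = (\<lambda>p\<in>U \<rightarrow>\<^sub>E A. \<mu> (\<lambda>s\<in>S. \<nu> (\<lambda>t\<in>T. p (s \<otimes> t))))"
    have U: "finite U" "U \<subseteq> carrier G" using S T by (auto simp: U_def)
    have STU: "s \<otimes> t \<in> U" if "s \<in> S" "t \<in> T" for s t using that by (auto simp: U_def)
    have \<rho>: "\<rho> \<in> (U \<rightarrow>\<^sub>E A) \<rightarrow>\<^sub>E A"
      unfolding \<rho>_def
    proof (rule restrict_PiE_iff[THEN iffD2], rule ballI)
      fix p assume p: "p \<in> U \<rightarrow>\<^sub>E A"
      have "(\<lambda>t\<in>T. p (s \<otimes> t)) \<in> T \<rightarrow>\<^sub>E A" if "s \<in> S" for s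
        using p STU that by (auto simp: PiE_iff)
      then have "(\<lambda>s\<in>S. \<nu> (\<lambda>t\<in>T. p (s \<otimes> t))) \<in> S \<rightarrow>\<^sub>E A"
        using T(3) by (auto simp: PiE_iff)
      then show "\<mu> (\<lambda>s\<in>S. \<nu> (\<lambda>t\<in>T. p (s \<otimes> t))) \<in> A" using S(3) by blast
    qed
    have main: "compose ?C \<sigma> \<tau> x g = \<rho> (restrict (shift G (inv g) x) U)"
      if x: "x \<in> ?C" and g: "g \<in> carrier G" for x g
    proof -
      have xU: "(\<lambda>u\<in>U. x (g \<otimes> u)) \<in> U \<rightarrow>\<^sub>E A"
        using x g U by (auto simp: configs_def PiE_iff)
      have "\<tau> x \<in> ?C" using \<tau>C x by blast
      then have "compose ?C \<sigma> \<tau> x g = \<mu> (\<lambda>s\<in>S. \<tau> x (g \<otimes> s))"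
        using S g x by (simp add: compose_def loc)
      also have "(\<lambda>s\<in>S. \<tau> x (g \<otimes> s)) = (\<lambda>s\<in>S. \<nu> (\<lambda>t\<in>T. (\<lambda>u\<in>U. x (g \<otimes> u)) (s \<otimes> t)))"
      proof (rule restrict_ext)
        fix s assume s: "s \<in> S"
        then have gs: "g \<otimes> s \<in> carrier G" using S g by auto
        have "(\<lambda>t\<in>T. x (g \<otimes> s \<otimes> t)) = (\<lambda>t\<in>T. (\<lambda>u\<in>U. x (g \<otimes> u)) (s \<otimes> t))"
          by (rule restrict_ext) (use s S T g STU in \<open>auto simp: m_assoc subset_iff\<close>)
        then show "\<tau> x (g \<otimes> s) = \<nu> (\<lambda>t\<in>T. (\<lambda>u\<in>U. x (g \<otimes> u)) (s \<otimes> t))"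
          using T(4)[OF x gs] loc[OF T(2) gs, of x] by simp
      qed
      also have "\<mu> \<dots> = \<rho> (restrict (shift G (inv g) x) U)"
        using xU loc[OF U(2) g, of x] by (simp add: \<rho>_def)
      finally show ?thesis .
    qed
    have "compose ?C \<sigma> \<tau> \<in> ?C \<rightarrow>\<^sub>E ?C"
      unfolding compose_def restrict_PiE_iff using \<sigma>C \<tau>C PiE_mem by metis
    then show ?thesis
      unfolding cellular_automaton_def
      by (intro conjI exI[of _ U] exI[of _ \<rho>] ballI U \<rho> main)
  qed
  have C: "\<tau> \<in> ?C \<rightarrow>\<^sub>E ?C" if "cellular_automaton G A \<tau>" for \<tau>
    using that by (simp add: cellular_automaton_def)
  show ?thesis
  proof (rule monoidI)
    fix \<rho> \<sigma> \<tau> assume "\<rho> \<in> carrier (CA G A)" "\<sigma> \<in> carrier (CA G A)" "\<tau> \<in> carrier (CA G A)"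
    then show "\<rho> \<otimes>\<^bsub>CA G A\<^esub> \<sigma> \<otimes>\<^bsub>CA G A\<^esub> \<tau> = \<rho> \<otimes>\<^bsub>CA G A\<^esub> (\<sigma> \<otimes>\<^bsub>CA G A\<^esub> \<tau>)"
      using C[of \<tau>] by (auto simp: CA_def PiE_iff intro!: compose_assoc[symmetric])
  next
    fix \<tau> assume "\<tau> \<in> carrier (CA G A)"
    then have "\<tau> \<in> ?C \<rightarrow>\<^sub>E ?C" by (simp add: CA_def C)
    then show "\<one>\<^bsub>CA G A\<^esub> \<otimes>\<^bsub>CA G A\<^esub> \<tau> = \<tau>" "\<tau> \<otimes>\<^bsub>CA G A\<^esub> \<one>\<^bsub>CA G A\<^esub> = \<tau>"
      by (auto simp: CA_def PiE_iff intro!: Id_compose compose_Id)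
  qed (auto simp: CA_def id comp)
qed

end

theory Submission
  imports Defs
begin

text \<open>Suppose a finite set \<open>T\<close> generates the monoid. All memory sets can be taken inside the subgroup
  generated by the memory sets of \<open>T\<close>; since translation by \<open>k\<close> needs \<open>k\<close> in its memory, \<open>G\<close> is
  finitely generated. Hence each set \<open>Fix n\<close> of configurations invariant under all \<open>n\<close>-th powers
  is finite, and as every automaton preserves it, a product is injective on \<open>Fix n\<close> only if both
  factors are. Choose \<open>n\<close> such that each element of \<open>T\<close> that fails to be injective on some
  \<open>Fix m\<close> already fails on \<open>Fix n\<close>: then any automaton injective on \<open>Fix n\<close> is injective on every
  \<open>Fix m\<close>. But since \<open>G\<close> is infinite and finitely generated, its \<open>n\<close>-th powers are not divisible,
  so some \<open>n\<close>-th power \<open>k\<close> is not an \<open>nm\<close>-th power, and the automaton that erases a symbol \<open>b\<close> at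
  \<open>g\<close> when it sees \<open>a\<close> at \<open>gk\<close> is the identity on \<open>Fix n\<close> but identifies the indicator of the
  \<open>nm\<close>-th powers with a constant.\<close>

lemma inj_on_compose_factors:
  assumes "finite D" "D \<subseteq> C" "\<sigma> ` D \<subseteq> D" "\<tau> ` D \<subseteq> D" "inj_on (compose C \<sigma> \<tau>) D"
  shows "inj_on \<sigma> D" "inj_on \<tau> D"
proof -
  have *: "inj_on (\<sigma> \<circ> \<tau>) D"
    using assms(2,5) by (auto simp: inj_on_def compose_def subset_iff)
  then show "inj_on \<tau> D" by (rule inj_on_imageI2)
  then have "\<tau> ` D = D" using assms(1,4) endo_inj_surj by blast
  then show "inj_on \<sigma> D" using inj_on_imageI[OF *] by simp
qed

section \<open>Finitely generated abelian groups\<close>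

context comm_group
begin

text \<open>Commutativity lets all occurrences of \<open>a\<close> in a word be collected in front.
  This drives the two inductions on generating sets below.\<close>

lemma generate_insertE:
  assumes "x \<in> generate G (insert a S)" "a \<in> carrier G" "S \<subseteq> carrier G"
  obtains i :: int and l where "l \<in> generate G S" "x = a [^] i \<otimes> l"
proof -
  interpret S: subgroup "generate G S" G
    by (rule generate_is_subgroup[OF assms(3)])
  from assms(1) have "\<exists>i::int. \<exists>l\<in>generate G S. x = a [^] i \<otimes> l"
  proof (induction rule: generate.induct)
    case one
    have "\<one> = a [^] (0::int) \<otimes> \<one>" by simp
    then show ?case using S.one_closed by blast
  next
    case (incl h)
    show ?case
    proof (cases "h = a")
      case True
      then have "h = a [^] (1::int) \<otimes> \<one>" using assms(2) by simp
      then show ?thesis using S.one_closed by blast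
    next
      case False
      then have "h \<in> generate G S" using incl by (auto intro: generate.incl)
      moreover from this have "h = a [^] (0::int) \<otimes> h" using S.mem_carrier by simp
      ultimately show ?thesis by blast
    qed
  next
    case (inv h)
    show ?case
    proof (cases "h = a")
      case True
      then have "inv h = a [^] (-1::int) \<otimes> \<one>" using assms(2) by (simp add: int_pow_neg)
      then show ?thesis using S.one_closed by blast
    next
      case False
      then have "inv h \<in> generate G S" using inv by (auto intro: generate.inv)
      moreover from this have "inv h = a [^] (0::int) \<otimes> inv h" using S.mem_carrier by simp
      ultimately show ?thesis by blast
    qed
  next
    case (eng h1 h2)
    then obtain i j :: int and l l' where
      l: "l \<in> generate G S" "l' \<in> generate G S" and h: "h1 = a [^] i \<otimes> l" "h2 = a [^] j \<otimes> l'"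
      by blast
    have "h1 \<otimes> h2 = a [^] (i + j) \<otimes> (l \<otimes> l')"
      using l assms(2) S.mem_carrier by (simp add: h int_pow_mult m_ac)
    then show ?case using l S.m_closed by blast
  qed
  then show thesis using that by blast
qed

text \<open>In a finitely generated abelian group the \<open>n\<close>-th powers have finite index,
  since exponents of generators matter only modulo \<open>n\<close>; \<open>R\<close> contains coset
  representatives.\<close>

lemma finite_power_transversal:
  assumes "finite S" "S \<subseteq> carrier G" "n > 0"
  shows "\<exists>R. finite R \<and> R \<subseteq> carrier G \<and>
    (\<forall>g\<in>generate G S. \<exists>r\<in>R. \<exists>h\<in>carrier G. g = h [^] (n::nat) \<otimes> r)"
  using assms(1,2)
proof (induction S rule: finite_induct)
  case empty
  have "\<one> = \<one> [^] n \<otimes> \<one>" by simp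
  then have "\<exists>h\<in>carrier G. \<one> = h [^] n \<otimes> \<one>" by blast
  then show ?case by (intro exI[of _ "{\<one>}"]) (simp add: generate_empty)
next
  case (insert a S)
  then have a: "a \<in> carrier G" and S: "S \<subseteq> carrier G" by auto
  obtain R where R: "finite R" "R \<subseteq> carrier G"
    "\<forall>g\<in>generate G S. \<exists>r\<in>R. \<exists>h\<in>carrier G. g = h [^] n \<otimes> r"
    using insert.IH S by blast
  define Q where "Q = (\<lambda>(e::nat, r). a [^] e \<otimes> r) ` ({..<n} \<times> R)"
  show ?case
  proof (intro exI[of _ Q] conjI ballI)
    show "finite Q" "Q \<subseteq> carrier G" using R a by (auto simp: Q_def)
  next
    fix g assume "g \<in> generate G (insert a S)"
    then obtain i :: int and l where l: "l \<in> generate G S" "g = a [^] i \<otimes> l"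
      using generate_insertE a S by metis
    then obtain r h where r: "r \<in> R" "h \<in> carrier G" "l = h [^] n \<otimes> r" using R by blast
    define e where "e = nat (i mod int n)"
    have e: "e < n" "i = (i div int n) * int n + int e"
      using assms(3) by (auto simp: e_def nat_less_iff)
    have rc: "r \<in> carrier G" using r R by blast
    have "a [^] i = (a [^] (i div int n)) [^] n \<otimes> a [^] e"
      using a int_pow_pow[OF a, of "i div int n" "int n"]
      by (subst e(2)) (simp add: int_pow_mult int_pow_int)
    then have "g = (a [^] (i div int n) \<otimes> h) [^] n \<otimes> (a [^] e \<otimes> r)"
      using a r rc by (simp add: l nat_pow_distrib m_ac)
    moreover have "a [^] e \<otimes> r \<in> Q" using e r by (auto simp: Q_def)
    ultimately show "\<exists>r\<in>Q. \<exists>h\<in>carrier G. g = h [^] n \<otimes> r" using a r by blast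
  qed
qed

lemma generate_divisible_trivial:
  assumes "finite S" "S \<subseteq> carrier G"
    and "\<And>x n. x \<in> generate G S \<Longrightarrow> n > 0 \<Longrightarrow> \<exists>y\<in>generate G S. x = y [^] (n::nat)"
  shows "generate G S = {\<one>}"
  using assms
proof (induction S rule: finite_induct)
  case empty
  then show ?case by (simp add: generate_empty)
next
  case (insert a S)
  then have a: "a \<in> carrier G" and S: "S \<subseteq> carrier G" by auto
  interpret S: subgroup "generate G S" G by (rule generate_is_subgroup[OF S])
  have a_root: "\<exists>i::int. \<exists>l\<in>generate G S. a = a [^] (i * int n) \<otimes> l" if n: "n > 0" for n :: nat
  proof -
    have "a \<in> generate G (insert a S)" by (auto intro: generate.incl)
    then obtain y where y: "y \<in> generate G (insert a S)" "a = y [^] n"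
      using insert.prems(2) n by blast
    then obtain i :: int and l where l: "l \<in> generate G S" "y = a [^] i \<otimes> l"
      using generate_insertE a S by metis
    have "l [^] n \<in> generate G S"
      by (induction n) (auto simp: l)
    moreover have "a [^] (i * int n) = (a [^] i) [^] n"
      using int_pow_pow[OF a, of i "int n"] by (simp add: int_pow_int)
    then have "y [^] n = a [^] (i * int n) \<otimes> l [^] n"
      using a l S.mem_carrier by (simp add: nat_pow_distrib)
    then have "a = a [^] (i * int n) \<otimes> l [^] n"
      using y(2) by (rule trans[rotated])
    ultimately show ?thesis by blast
  qed
  have int_pow: "x [^] (i::int) \<in> generate G S" if "x \<in> generate G S" for x i
    using that S.subgroup_axioms subgroup_int_pow_closed by blast
  have "a \<in> generate G S"
  proof -
    obtain i :: int and l where l: "l \<in> generate G S" "a = a [^] (i * int 2) \<otimes> l"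
      using a_root[of 2] by auto
    \<comment> \<open>Taking a square root of \<open>a\<close> makes this exponent odd, hence
      nonzero: some nontrivial power of \<open>a\<close> lies in
      \<open>generate G S\<close>.\<close>
    define j where "j = 1 - i * 2"
    have "a [^] j = l"
    proof -
      have "a [^] j = a \<otimes> inv (a [^] (i * 2))"
        using a by (simp add: j_def int_pow_diff int_pow_1)
      also have "\<dots> = (a [^] (i * 2) \<otimes> l) \<otimes> inv (a [^] (i * 2))"
        by (rule arg_cong[where f = "\<lambda>z. z \<otimes> _"]) (use l(2) in \<open>simp only: of_nat_numeral\<close>)
      also have "\<dots> = l"
        using a l(1) S.mem_carrier by (simp add: m_comm[of _ l] m_assoc)
      finally show ?thesis .
    qed
    then have j: "a [^] j \<in> generate G S" using l by simp
    have "j \<noteq> 0" unfolding j_def by presburger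
    \<comment> \<open>With an \<open>n\<close>-th root for this \<open>n\<close>, the exponent of
      \<open>a\<close> on the right of \<open>a_root\<close> becomes a multiple of \<open>j\<close>,
      so both factors lie in \<open>generate G S\<close>.\<close>
    define n where "n = nat \<bar>j\<bar>"
    have n: "n > 0" using \<open>j \<noteq> 0\<close> by (simp add: n_def)
    obtain i' :: int and l' where l': "l' \<in> generate G S" "a = a [^] (i' * int n) \<otimes> l'"
      using a_root[OF n] by auto
    have "int n = j * sgn j" by (simp add: n_def flip: abs_sgn)
    then have "i' * int n = j * (i' * sgn j)" by (simp add: mult.left_commute)
    then have "a [^] (i' * int n) = (a [^] j) [^] (i' * sgn j)"
      using a by (simp only: int_pow_pow)
    then have "a [^] (i' * int n) \<in> generate G S" using int_pow[OF j] by simp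
    then show ?thesis using l' S.m_closed by metis
  qed
  then have "insert a S \<subseteq> generate G S" by (auto intro: generate.incl)
  then have "generate G (insert a S) = generate G S"
    using generate_subgroup_incl[OF _ S.subgroup_axioms] mono_generate[of S "insert a S"] by blast
  then show ?case using insert.IH[OF S] insert.prems(2) by simp
qed

text \<open>Otherwise the group of \<open>n\<close>-th powers would be divisible; it is generated by
  the \<open>n\<close>-th powers of \<open>S\<close>, so it would be trivial. Having finite index,
  it would leave \<open>G\<close> finite.\<close>

lemma exists_nondivisible_power:
  assumes "infinite (carrier G)" "finite S" "S \<subseteq> carrier G" "generate G S = carrier G" "n > 0"
  obtains g and m :: nat where "g \<in> carrier G" "m > 0"
    "\<And>h. h \<in> carrier G \<Longrightarrow> g [^] (n::nat) \<noteq> h [^] (n * m)"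
proof (rule ccontr)
  assume "\<not> thesis"
  then have div: "\<exists>h\<in>carrier G. g [^] n = h [^] (n * m)" if "g \<in> carrier G" "m > 0" for g and m :: nat
    using that \<open>\<And>g m. \<lbrakk>g \<in> carrier G; m > 0; \<And>h. h \<in> carrier G \<Longrightarrow> g [^] n \<noteq> h [^] (n * m)\<rbrakk> \<Longrightarrow> thesis\<close>
    by blast
  let ?f = "\<lambda>g. g [^] n"
  interpret f: group_hom G G ?f
    by unfold_locales (auto simp: hom_def nat_pow_distrib)
  have K: "generate G (?f ` S) = ?f ` carrier G"
    using f.generate_img[OF assms(3)] assms(4) by simp
  have "generate G (?f ` S) = {\<one>}"
  proof (rule generate_divisible_trivial)
    show "finite (?f ` S)" "?f ` S \<subseteq> carrier G" using assms by auto
  next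
    fix x and m :: nat assume "x \<in> generate G (?f ` S)" "m > 0"
    then obtain g where "g \<in> carrier G" "x = g [^] n" by (auto simp: K)
    then obtain h where "h \<in> carrier G" "x = h [^] (n * m)" using div \<open>m > 0\<close> by metis
    \<comment> \<open>The root is \<open>h [^] n\<close>, which is again an \<open>n\<close>-th
      power.\<close>
    then show "\<exists>y\<in>generate G (?f ` S). x = y [^] m" by (auto simp: K nat_pow_pow)
  qed
  then have triv: "g [^] n = \<one>" if "g \<in> carrier G" for g
    using that K by blast
  obtain R where R: "finite R" "R \<subseteq> carrier G"
    "\<forall>g\<in>carrier G. \<exists>r\<in>R. \<exists>h\<in>carrier G. g = h [^] n \<otimes> r"
    using finite_power_transversal[OF assms(2,3,5)] assms(4) by auto
  have "carrier G \<subseteq> R"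
  proof
    fix g assume "g \<in> carrier G"
    then obtain r h where "r \<in> R" "h \<in> carrier G" "g = h [^] n \<otimes> r" using R by blast
    then show "g \<in> R" using triv R by auto
  qed
  then show False using assms(1) R finite_subset by blast
qed

section \<open>Cellular automata\<close>

lemma CA_local:
  fixes A :: "'c set"
  assumes "cellular_automaton G A \<tau>"
  obtains S \<mu> where "finite S" "S \<subseteq> carrier G"
    "\<And>x g. x \<in> configs G A \<Longrightarrow> g \<in> carrier G \<Longrightarrow> \<tau> x g = \<mu> (\<lambda>s\<in>S. x (g \<otimes> s))"
proof -
  obtain S \<mu> where S: "finite S" "S \<subseteq> carrier G"
    and \<mu>: "\<And>x g. x \<in> configs G A \<Longrightarrow> g \<in> carrier G \<Longrightarrow>
      \<tau> x g = \<mu> (restrict (shift G (inv g) x) S)"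
    using assms unfolding cellular_automaton_def by auto
  have "restrict (shift G (inv g) x) S = (\<lambda>s\<in>S. x (g \<otimes> s))" if "g \<in> carrier G" for g and x :: "'a \<Rightarrow> 'c"
    using that S by (auto simp: shift_def restrict_def fun_eq_iff)
  then show thesis using that[OF S, of \<mu>] \<mu> by simp
qed

text \<open>One family supplies both witnesses: translation by \<open>k\<close>, with
  \<open>f u v = v\<close>, and the automaton that erases a symbol.\<close>

definition two_site_rule :: "'c set \<Rightarrow> ('c \<Rightarrow> 'c \<Rightarrow> 'c) \<Rightarrow> 'a \<Rightarrow> ('a \<Rightarrow> 'c) \<Rightarrow> 'a \<Rightarrow> 'c" where
  "two_site_rule A f k = (\<lambda>x\<in>configs G A. \<lambda>g\<in>carrier G. f (x g) (x (g \<otimes> k)))"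

lemma cellular_automaton_two_site_rule:
  assumes "k \<in> carrier G" and f: "\<And>u v. u \<in> A \<Longrightarrow> v \<in> A \<Longrightarrow> f u v \<in> A"
  shows "cellular_automaton G A (two_site_rule A f k)"
  unfolding cellular_automaton_def
proof (intro conjI exI[of _ "{\<one>, k}"] exI[of _ "\<lambda>p\<in>{\<one>, k} \<rightarrow>\<^sub>E A. f (p \<one>) (p k)"] ballI)
  show "two_site_rule A f k \<in> configs G A \<rightarrow>\<^sub>E configs G A"
    using assms by (auto simp: two_site_rule_def configs_def PiE_iff)
  fix x g assume x: "x \<in> configs G A" and g: "g \<in> carrier G"
  define p where "p = restrict (shift G (inv g) x) {\<one>, k}"
  have p: "p = (\<lambda>s\<in>{\<one>, k}. x (g \<otimes> s))"
    using g assms(1) by (auto simp: p_def shift_def fun_eq_iff)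
  have "p \<in> {\<one>, k} \<rightarrow>\<^sub>E A"
    unfolding p using x g assms(1) by (auto simp: configs_def PiE_iff)
  moreover have "p \<one> = x g" "p k = x (g \<otimes> k)"
    unfolding p using g by auto
  ultimately show "two_site_rule A f k x g =
      (\<lambda>p\<in>{\<one>, k} \<rightarrow>\<^sub>E A. f (p \<one>) (p k)) (restrict (shift G (inv g) x) {\<one>, k})"
    using x g unfolding p_def[symmetric] by (simp add: two_site_rule_def)
qed (use assms in \<open>auto simp: PiE_iff\<close>)

section \<open>Periodic configurations\<close>

text \<open>This is \<open>Fix n\<close> of the overview; its elements correspond to functions on
  the quotient of \<open>G\<close> by its \<open>n\<close>-th powers.\<close>

definition periodic_configs :: "'c set \<Rightarrow> nat \<Rightarrow> ('a \<Rightarrow> 'c) set" where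
  "periodic_configs A n =
    {x \<in> configs G A. \<forall>g\<in>carrier G. \<forall>h\<in>carrier G. x (g [^] n \<otimes> h) = x h}"

lemma periodic_configs_mono: "periodic_configs A n \<subseteq> periodic_configs A (n * m)"
proof
  fix x assume x: "x \<in> periodic_configs A n"
  have "x (g [^] (n * m) \<otimes> h) = x h" if "g \<in> carrier G" "h \<in> carrier G" for g h
  proof -
    have "g [^] (n * m) = (g [^] m) [^] n" using that by (simp add: nat_pow_pow mult.commute)
    then show ?thesis using x that by (simp add: periodic_configs_def)
  qed
  then show "x \<in> periodic_configs A (n * m)" using x by (simp add: periodic_configs_def)
qed

text \<open>A periodic configuration is determined by its values on a finite transversal of the
  \<open>n\<close>-th powers.\<close>

lemma finite_periodic_configs:
  fixes A :: "'c set"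
  assumes "finite S" "S \<subseteq> carrier G" "generate G S = carrier G" "n > 0" "finite A"
  shows "finite (periodic_configs A n)"
proof -
  obtain R where R: "finite R" "R \<subseteq> carrier G"
    "\<forall>g\<in>carrier G. \<exists>r\<in>R. \<exists>h\<in>carrier G. g = h [^] n \<otimes> r"
    using finite_power_transversal[OF assms(1,2,4)] assms(3) by auto
  let ?r = "\<lambda>x::'a \<Rightarrow> 'c. restrict x R"
  have "inj_on ?r (periodic_configs A n)"
  proof (rule inj_onI)
    fix x y assume x: "x \<in> periodic_configs A n" and y: "y \<in> periodic_configs A n"
      and eq: "?r x = ?r y"
    have "x g = y g" if "g \<in> carrier G" for g
    proof -
      obtain r h where r: "r \<in> R" "h \<in> carrier G" "g = h [^] n \<otimes> r" using R(3) \<open>g \<in> carrier G\<close> by blast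
      then have "r \<in> carrier G" using R by blast
      then have "x g = x r" "y g = y r"
        using x y r(2) by (simp_all add: r(3) periodic_configs_def)
      then show ?thesis using fun_cong[OF eq, of r] r by simp
    qed
    moreover have "x \<in> carrier G \<rightarrow>\<^sub>E A" "y \<in> carrier G \<rightarrow>\<^sub>E A"
      using x y by (simp_all add: periodic_configs_def configs_def)
    ultimately show "x = y" by (intro PiE_ext)
  qed
  moreover have "?r ` periodic_configs A n \<subseteq> R \<rightarrow>\<^sub>E A"
    using R(2) by (auto simp: periodic_configs_def configs_def PiE_iff)
  then have "finite (?r ` periodic_configs A n)"
    using finite_PiE[of R "\<lambda>_. A"] R(1) assms(5) finite_subset by blast
  ultimately show ?thesis using finite_imageD by blast
qed

text \<open>The windows at \<open>h\<close> and at \<open>g [^] n \<otimes> h\<close> show the same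
  pattern of a periodic configuration.\<close>

lemma CA_periodic_configs:
  assumes "cellular_automaton G A \<tau>"
  shows "\<tau> ` periodic_configs A n \<subseteq> periodic_configs A n"
proof
  fix y assume "y \<in> \<tau> ` periodic_configs A n"
  then obtain x where x: "x \<in> periodic_configs A n" and y: "y = \<tau> x" by blast
  have xc: "x \<in> configs G A" using x by (simp add: periodic_configs_def)
  obtain S \<mu> where S: "finite S" "S \<subseteq> carrier G"
    and \<mu>: "\<And>x g. x \<in> configs G A \<Longrightarrow> g \<in> carrier G \<Longrightarrow> \<tau> x g = \<mu> (\<lambda>s\<in>S. x (g \<otimes> s))"
    by (rule CA_local[OF assms]) blast
  have "\<tau> x (g [^] n \<otimes> h) = \<tau> x h" if g: "g \<in> carrier G" "h \<in> carrier G" for g h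
  proof -
    have "(\<lambda>s\<in>S. x (g [^] n \<otimes> h \<otimes> s)) = (\<lambda>s\<in>S. x (h \<otimes> s))"
      by (rule restrict_ext) (use x g S in \<open>auto simp: periodic_configs_def m_assoc subset_iff\<close>)
    then show ?thesis using \<mu>[OF xc] g by simp
  qed
  moreover have "\<tau> x \<in> configs G A" using assms xc by (auto simp: cellular_automaton_def)
  ultimately show "y \<in> periodic_configs A n" by (simp add: periodic_configs_def y)
qed

text \<open>The implication from injectivity at level \<open>n\<close> to injectivity at level
  \<open>m\<close> passes to products: finiteness at level \<open>n\<close> splits injectivity into
  the factors, and at level \<open>m\<close> injective factors compose.\<close>

lemma CA_generate_inj_on_periodic:
  assumes T: "T \<subseteq> carrier (CA G A)" and fin: "finite (periodic_configs A n)"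
    and inj: "\<And>s m. s \<in> T \<Longrightarrow> inj_on s (periodic_configs A n) \<Longrightarrow> m > 0 \<Longrightarrow> inj_on s (periodic_configs A m)"
    and \<tau>: "\<tau> \<in> monoid_generate (CA G A) T" "inj_on \<tau> (periodic_configs A n)" and m: "m > 0"
  shows "inj_on \<tau> (periodic_configs A m)"
proof -
  interpret CA: monoid "CA G A" by (rule monoid_CA)
  have X: "periodic_configs A j \<subseteq> configs G A" for j by (auto simp: periodic_configs_def)
  have "\<tau> \<in> carrier (CA G A) \<and>
    (inj_on \<tau> (periodic_configs A n) \<longrightarrow> inj_on \<tau> (periodic_configs A m))"
    using \<tau>(1)
  proof (induction rule: monoid_generate.induct)
    case one
    have "inj_on (\<lambda>x\<in>configs G A. x) (periodic_configs A m)"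
      using X[of m] by (auto simp: inj_on_def subset_iff)
    then have "inj_on \<one>\<^bsub>CA G A\<^esub> (periodic_configs A m)" by (simp add: CA_def)
    then show ?case using CA.one_closed by blast
  next
    case (incl x)
    then show ?case using T inj m by auto
  next
    case (mult s t)
    then have st: "cellular_automaton G A s" "cellular_automaton G A t" by (auto simp: CA_def)
    have eq: "s \<otimes>\<^bsub>CA G A\<^esub> t = compose (configs G A) s t" by (simp add: CA_def)
    have "inj_on (compose (configs G A) s t) (periodic_configs A m)"
      if "inj_on (compose (configs G A) s t) (periodic_configs A n)"
    proof -
      have "inj_on s (periodic_configs A n)" "inj_on t (periodic_configs A n)"
        using inj_on_compose_factors[OF fin X _ _ that] CA_periodic_configs st by blast+
      then have "inj_on s (periodic_configs A m)" "inj_on t (periodic_configs A m)"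
        using mult.IH by auto
      then have "inj_on (s \<circ> t) (periodic_configs A m)"
        using CA_periodic_configs[OF st(2), of m] by (blast intro: comp_inj_on inj_on_subset)
      then show ?thesis using X[of m] by (auto simp: inj_on_def compose_def subset_iff)
    qed
    moreover have "s \<otimes>\<^bsub>CA G A\<^esub> t \<in> carrier (CA G A)" using mult.IH CA.m_closed by blast
    ultimately show ?case unfolding eq by blast
  qed
  then show ?thesis using \<tau>(2) by blast
qed

section \<open>Memory sets and finite generation of the group\<close>

text \<open>Stated by agreement of configurations instead of a local map, so that an infinite
  subgroup may serve as \<open>H\<close> and enlarging \<open>H\<close> preserves the
  property.\<close>

definition memory_in :: "'c set \<Rightarrow> 'a set \<Rightarrow> (('a \<Rightarrow> 'c) \<Rightarrow> 'a \<Rightarrow> 'c) \<Rightarrow> bool" where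
  "memory_in A H \<tau> \<longleftrightarrow> (\<forall>x\<in>configs G A. \<forall>y\<in>configs G A. \<forall>g\<in>carrier G.
     (\<forall>h\<in>H. x (g \<otimes> h) = y (g \<otimes> h)) \<longrightarrow> \<tau> x g = \<tau> y g)"

lemma memory_inD:
  assumes "memory_in A H \<tau>" "x \<in> configs G A" "y \<in> configs G A" "g \<in> carrier G"
    and "\<And>h. h \<in> H \<Longrightarrow> x (g \<otimes> h) = y (g \<otimes> h)"
  shows "\<tau> x g = \<tau> y g"
  using assms unfolding memory_in_def by blast

text \<open>A composition reads the sites \<open>g \<otimes> h \<otimes> h'\<close> with
  \<open>h\<close> and \<open>h'\<close> in \<open>H\<close>; closure of \<open>H\<close> under
  products keeps them in the coset of \<open>g\<close>.\<close>

lemma CA_generate_memory: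
  fixes A :: "'c set"
  assumes H: "subgroup H G" and T: "T \<subseteq> carrier (CA G A)"
    and mem: "\<And>s. s \<in> T \<Longrightarrow> memory_in A H s"
    and \<tau>: "\<tau> \<in> monoid_generate (CA G A) T"
  shows "memory_in A H \<tau>"
proof -
  interpret H: subgroup H G by (rule H)
  interpret CA: monoid "CA G A" by (rule monoid_CA)
  have "\<tau> \<in> carrier (CA G A) \<and> memory_in A H \<tau>"
    using \<tau>
  proof (induction rule: monoid_generate.induct)
    case one
    have "x g = y g" if "g \<in> carrier G" "\<forall>h\<in>H. x (g \<otimes> h) = y (g \<otimes> h)" for x y :: "'a \<Rightarrow> 'c" and g
      using bspec[OF that(2) H.one_closed] that(1) by simp
    then have "memory_in A H (\<lambda>x\<in>configs G A. x)" by (auto simp: memory_in_def)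
    then have "memory_in A H \<one>\<^bsub>CA G A\<^esub>" by (simp add: CA_def)
    then show ?case using CA.one_closed by blast
  next
    case (incl x)
    then show ?case using T mem by auto
  next
    case (mult s t)
    then have t: "t \<in> configs G A \<rightarrow>\<^sub>E configs G A" by (auto simp: CA_def cellular_automaton_def)
    have eq: "s \<otimes>\<^bsub>CA G A\<^esub> t = compose (configs G A) s t" by (simp add: CA_def)
    have "memory_in A H (compose (configs G A) s t)"
      unfolding memory_in_def
    proof (intro ballI impI)
      fix x y g assume x: "x \<in> configs G A" and y: "y \<in> configs G A" and g: "g \<in> carrier G"
        and xy: "\<forall>h\<in>H. x (g \<otimes> h) = y (g \<otimes> h)"
      have "t x (g \<otimes> h) = t y (g \<otimes> h)" if h: "h \<in> H" for h
      proof -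
        have "x (g \<otimes> h \<otimes> h') = y (g \<otimes> h \<otimes> h')" if "h' \<in> H" for h'
          using xy h that g H.mem_carrier by (simp add: m_assoc)
        moreover have "g \<otimes> h \<in> carrier G" using g h by simp
        ultimately show ?thesis using mult.IH(2) x y memory_inD by blast
      qed
      moreover have "t x \<in> configs G A" "t y \<in> configs G A" using t x y by auto
      ultimately have "s (t x) g = s (t y) g" using mult.IH(1) g memory_inD by blast
      then show "compose (configs G A) s t x g = compose (configs G A) s t y g"
        using x y by (simp add: compose_def)
    qed
    moreover have "s \<otimes>\<^bsub>CA G A\<^esub> t \<in> carrier (CA G A)" using mult.IH CA.m_closed by blast
    ultimately show ?case unfolding eq by blast
  qed
  then show ?thesis ..
qed

text \<open>Every automaton reads only within the subgroup generated by the memory sets of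
  \<open>T\<close>. Translation by \<open>k\<close> reads exactly the site \<open>k\<close>, so this
  subgroup contains every \<open>k\<close>.\<close>

lemma CA_finitely_generated_imp_group_finitely_generated:
  assumes T: "finite T" "T \<subseteq> carrier (CA G A)" "monoid_generate (CA G A) T = carrier (CA G A)"
    and ab: "a \<in> A" "b \<in> A" "a \<noteq> b"
  obtains S where "finite S" "S \<subseteq> carrier G" "generate G S = carrier G"
proof -
  have "\<exists>S. finite S \<and> S \<subseteq> carrier G \<and> memory_in A S s" if "s \<in> T" for s
  proof -
    obtain S \<mu> where S: "finite S" "S \<subseteq> carrier G"
      and \<mu>: "\<And>x g. x \<in> configs G A \<Longrightarrow> g \<in> carrier G \<Longrightarrow> s x g = \<mu> (\<lambda>u\<in>S. x (g \<otimes> u))"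
      using CA_local[of A s] T(2) \<open>s \<in> T\<close> by (auto simp: CA_def)
    have "memory_in A S s"
      unfolding memory_in_def
    proof (intro ballI impI)
      fix x y g assume x: "x \<in> configs G A" "y \<in> configs G A" "g \<in> carrier G"
        and "\<forall>h\<in>S. x (g \<otimes> h) = y (g \<otimes> h)"
      then have "(\<lambda>u\<in>S. x (g \<otimes> u)) = (\<lambda>u\<in>S. y (g \<otimes> u))" by (auto intro: restrict_ext)
      then show "s x g = s y g" using \<mu> x by simp
    qed
    then show ?thesis using S by blast
  qed
  then obtain M where M: "\<And>s. s \<in> T \<Longrightarrow> finite (M s) \<and> M s \<subseteq> carrier G \<and> memory_in A (M s) s"
    by metis
  define S where "S = (\<Union>s\<in>T. M s)"
  have S: "finite S" "S \<subseteq> carrier G" using M T(1) by (auto simp: S_def)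
  let ?H = "generate G S"
  interpret H: subgroup ?H G by (rule generate_is_subgroup[OF S(2)])
  have memT: "memory_in A ?H s" if "s \<in> T" for s
  proof -
    have "M s \<subseteq> ?H" using that by (auto simp: S_def intro: generate.incl)
    then show ?thesis using M[OF that] unfolding memory_in_def by blast
  qed
  have "k \<in> ?H" if k: "k \<in> carrier G" for k
  proof (rule ccontr)
    assume nk: "k \<notin> ?H"
    let ?\<sigma> = "two_site_rule A (\<lambda>u v. v) k"
    define x where "x = (\<lambda>g\<in>carrier G. a)"
    \<comment> \<open>It differs from \<open>x\<close> only at \<open>k\<close>, which is invisible
      from \<open>\<one>\<close> through \<open>?H\<close> but is the one site that translation by
      \<open>k\<close> looks at.\<close>
    define y where "y = (\<lambda>g\<in>carrier G. if g = k then b else a)"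
    have xy: "x \<in> configs G A" "y \<in> configs G A"
      using ab by (auto simp: x_def y_def configs_def)
    have "?\<sigma> \<in> monoid_generate (CA G A) T"
      using T(3) cellular_automaton_two_site_rule[OF k, of A "\<lambda>u v. v"] by (simp add: CA_def)
    then have "memory_in A ?H ?\<sigma>"
      using CA_generate_memory[OF H.subgroup_axioms T(2) memT] by blast
    moreover have "\<forall>h\<in>?H. x (\<one> \<otimes> h) = y (\<one> \<otimes> h)"
      using nk H.mem_carrier by (auto simp: x_def y_def)
    ultimately have "?\<sigma> x \<one> = ?\<sigma> y \<one>" using memory_inD[OF _ xy] by blast
    then show False using xy k ab by (simp add: two_site_rule_def x_def y_def)
  qed
  then have "?H = carrier G" using H.subset by blast
  then show thesis using that S by blast
qed

section \<open>An automaton separating two periods\<close>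

lemma exists_CA_separating_periods:
  assumes g: "g \<in> carrier G" and ng: "\<And>h. h \<in> carrier G \<Longrightarrow> g [^] n \<noteq> h [^] (n * m)"
    and ab: "a \<in> A" "b \<in> A" "a \<noteq> b"
  obtains \<tau> where "cellular_automaton G A \<tau>"
    "inj_on \<tau> (periodic_configs A n)" "\<not> inj_on \<tau> (periodic_configs A (n * m))"
proof -
  define k where "k = g [^] n"
  define P where "P = (\<lambda>h. h [^] (n * m)) ` carrier G"
  have k: "k \<in> carrier G" "k \<notin> P" using g ng by (auto simp: k_def P_def)
  interpret hom: group_hom G G "\<lambda>h. h [^] (n * m)"
    by unfold_locales (auto simp: hom_def nat_pow_distrib)
  interpret P: subgroup P G unfolding P_def by (rule hom.img_is_subgroup)
  \<comment> \<open>The rule changes a symbol only if the sites \<open>h\<close> and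
    \<open>h \<otimes> k\<close> carry different symbols, which never happens when \<open>k\<close>
    is a period.\<close>
  define f where "f = (\<lambda>u v. if u = b \<and> v = a then a else u)"
  let ?\<tau> = "two_site_rule A f k"
  have CA: "cellular_automaton G A ?\<tau>"
    by (rule cellular_automaton_two_site_rule) (use k ab in \<open>auto simp: f_def\<close>)
  have "?\<tau> x = x" if x: "x \<in> periodic_configs A n" for x
  proof -
    have xc: "x \<in> configs G A" using x by (simp add: periodic_configs_def)
    have "x (h \<otimes> k) = x h" if "h \<in> carrier G" for h
      using x g that by (simp add: periodic_configs_def k_def m_comm)
    then have "?\<tau> x = (\<lambda>h\<in>carrier G. x h)"
      using xc ab by (auto simp: two_site_rule_def f_def fun_eq_iff)
    also have "\<dots> = x" using xc by (auto simp: configs_def PiE_iff extensional_restrict)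
    finally show ?thesis .
  qed
  then have inj: "inj_on ?\<tau> (periodic_configs A n)" by (metis inj_onI)
  define x where "x = (\<lambda>h\<in>carrier G. a)"
  define y where "y = (\<lambda>h\<in>carrier G. if h \<in> P then b else a)"
  have P_iff: "p \<otimes> h \<in> P \<longleftrightarrow> h \<in> P" if p: "p \<in> P" and h: "h \<in> carrier G" for p h
  proof
    assume "p \<otimes> h \<in> P"
    then have "inv p \<otimes> (p \<otimes> h) \<in> P" by (rule P.m_closed[OF P.m_inv_closed[OF p]])
    moreover have "inv p \<otimes> (p \<otimes> h) = h" using p h P.mem_carrier by (simp flip: m_assoc)
    ultimately show "h \<in> P" by metis
  qed (use p in simp)
  have xy: "x \<in> configs G A" "y \<in> configs G A"
    using ab by (auto simp: x_def y_def configs_def)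
  have "x \<in> periodic_configs A (n * m)" using xy by (auto simp: periodic_configs_def x_def)
  moreover have "y \<in> periodic_configs A (n * m)"
    using xy P_iff by (auto simp: periodic_configs_def y_def P_def)
  \<comment> \<open>For \<open>h\<close> in \<open>P\<close> the site \<open>h \<otimes> k\<close>
    lies outside \<open>P\<close>, because \<open>k\<close> does. So every \<open>b\<close> in
    \<open>y\<close> sees an \<open>a\<close> and is erased, and both images are constantly
    \<open>a\<close>.\<close>
  moreover have "?\<tau> x = ?\<tau> y"
    using xy k ab P_iff[of _ k]
    by (auto simp: two_site_rule_def f_def x_def y_def fun_eq_iff)
  moreover have "x \<one> \<noteq> y \<one>" using ab by (simp add: x_def y_def)
  ultimately have "\<not> inj_on ?\<tau> (periodic_configs A (n * m))" by (metis inj_onD)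
  then show thesis using that CA inj by blast
qed

end

section \<open>Contradiction from a finite generating set\<close>

theorem theorem5:
  fixes G :: "('g, 'n) monoid_scheme" and A :: "'a set" and q :: nat
  assumes "comm_group G" and "infinite (carrier G)"
    and "finite A" and "card A = q" and "q \<ge> 2"
  shows "\<not> finitely_generated_monoid (CA G A)"
proof
  interpret G: comm_group G by (rule assms(1))
  let ?F = "G.periodic_configs A"
  assume "finitely_generated_monoid (CA G A)"
  then obtain T where T: "finite T" "T \<subseteq> carrier (CA G A)"
    "monoid_generate (CA G A) T = carrier (CA G A)"
    unfolding finitely_generated_monoid_def by blast
  obtain a b where ab: "a \<in> A" "b \<in> A" "a \<noteq> b"
    using assms(3-5) card_le_Suc0_iff_eq[of A] by force
  obtain S where S: "finite S" "S \<subseteq> carrier G" "generate G S = carrier G"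
    using G.CA_finitely_generated_imp_group_finitely_generated[OF T ab] .
  \<comment> \<open>Take a level at which \<open>s\<close> fails to be injective if there is one,
    and \<open>1\<close> otherwise.\<close>
  have "\<exists>n>0. \<forall>m>0. \<not> inj_on s (?F m) \<longrightarrow> \<not> inj_on s (?F n)" for s
    using zero_less_one[where 'a = nat] by blast
  then obtain N where N: "\<And>s. s \<in> T \<Longrightarrow> N s > (0::nat)"
    "\<And>s m. s \<in> T \<Longrightarrow> m > 0 \<Longrightarrow> \<not> inj_on s (?F m) \<Longrightarrow> \<not> inj_on s (?F (N s))"
    by metis
  \<comment> \<open>A common multiple of all \<open>N s\<close>: each \<open>?F (N s)\<close> lies
    in \<open>?F n\<close>, so a failure of injectivity at level \<open>N s\<close> persists at
    level \<open>n\<close>.\<close>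
  define n where "n = prod N T"
  have n: "n > 0" using N(1) by (simp add: n_def prod_pos)
  have inj: "inj_on s (?F m)" if s: "s \<in> T" "inj_on s (?F n)" "m > 0" for s m
  proof (rule ccontr)
    assume "\<not> inj_on s (?F m)"
    then have "\<not> inj_on s (?F (N s))" using N(2) s by blast
    moreover have "n = N s * prod N (T - {s})" using T(1) s(1) by (simp add: n_def prod.remove)
    then have "?F (N s) \<subseteq> ?F n" using G.periodic_configs_mono by metis
    ultimately show False using s(2) inj_on_subset by blast
  qed
  obtain g m where gm: "g \<in> carrier G" "m > 0"
    "\<And>h. h \<in> carrier G \<Longrightarrow> g [^]\<^bsub>G\<^esub> n \<noteq> h [^]\<^bsub>G\<^esub> (n * m)"
    by (rule G.exists_nondivisible_power[OF assms(2) S n]) blast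
  obtain \<tau> where \<tau>: "cellular_automaton G A \<tau>" "inj_on \<tau> (?F n)" "\<not> inj_on \<tau> (?F (n * m))"
    using G.exists_CA_separating_periods[OF gm(1,3) ab] .
  have "\<tau> \<in> monoid_generate (CA G A) T" using \<tau>(1) T(3) by (simp add: CA_def)
  then have "inj_on \<tau> (?F (n * m))"
    using G.CA_generate_inj_on_periodic[OF T(2) G.finite_periodic_configs[OF S n assms(3)] inj]
      \<tau>(2) n gm(2) by simp
  then show False using \<tau>(3) by blast
qed

end
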